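(* Let $n,b\in\mathbb{N}$ with $1\le b<\frac n2$, and let $\xi_1,\dots,\xi_b$ be independent identically distributed real random variables with mean $a:=\mathbb{E}\xi_k$, variance $\sigma^2:=\mathbb{E}|\xi_k-a|^2<\infty$ ($\sigma\ge0$), and $\mathbb{E}|\xi_k-a|^3<\infty$. Let $\mathbb{A}_{n,b}=\mathrm{Circ}(0,\xi_1,\dots,\xi_b,0,\dots,0,\xi_b,\dots,\xi_1)$ be the corresponding random real symmetric band circulant $n\times n$ matrix, and let $\widetilde{\mathbb{A}}_{n,b}$ be the random real symmetric band Toeplitz $n\times n$ matrix $\text{Toep}_s(0,\xi_1,\dots,\xi_b,0,\dots,0)$. Then $$ \frac1{n\sqrt{b}}\,\left|\mathbb{E}\,\mathcal{E}(\widetilde{\mathbb{A}}_{n,b})-\mathbb{E}\,\mathcal{E}(\mathbb{A}_{n,b})\right|\leq\frac{(\mathbb{E}\xi_k^2)^{\frac12}}{n}\sqrt{2\,b(b+1)} \leq2\,(|a|+\sigma)\,\frac{b}{n}\,. $$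
   Context: For $a_0,\dots,a_{n-1}\in\mathbb{C}$, $\mathrm{Circ}(a_0,\dots,a_{n-1})$ denotes the $n\times n$ circulant matrix whose $(i,j)$ entry is $a_{(j-i)\bmod n}$. In $\mathrm{Circ}(0,\xi_1,\dots,\xi_b,0,\dots,0,\xi_b,\dots,\xi_1)$ the generating tuple is $a_0=0$, $a_k=a_{n-k}=\xi_k$ for $1\le k\le b$, and $a_k=0$ for $b<k<n-b$; the number $b<n/2$ is the band width. For real $a_0,\dots,a_{n-1}$, $\text{Toep}_s(a_0,a_1,\dots,a_{n-1})$ denotes the real symmetric Toeplitz $n\times n$ matrix whose $(i,j)$ entry is $a_{|j-i|}$. In $\text{Toep}_s(0,\xi_1,\dots,\xi_b,0,\dots,0)$ the $(i,j)$ entry is $\xi_{|j-i|}$ if $1\le|j-i|\le b$ and $0$ otherwise. The matrix energy (trace norm) of an $n\times n$ matrix $A$ is $\mathcal{E}(A):=\mathrm{tr}|A|=\mathrm{tr}\big((A^*A)^{1/2}\big)$, the sum of the singular values of $A$; for real symmetric $A$ it is the sum of the absolute values of the eigenvalues. *)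

theory Defs
  imports "HOL-Probability.Probability" "Jordan_Normal_Form.Schur_Decomposition"
begin

definition circ :: "nat \<Rightarrow> (nat \<Rightarrow> 'a) \<Rightarrow> 'a mat" where
  "circ n a = mat n n (\<lambda>(i, j). a (nat ((int j - int i) mod int n)))"

definition toep_s :: "nat \<Rightarrow> (nat \<Rightarrow> real) \<Rightarrow> real mat" where
  "toep_s n a = mat n n (\<lambda>(i, j). a (nat \<bar>int j - int i\<bar>))"

definition band_circ :: "nat \<Rightarrow> nat \<Rightarrow> (nat \<Rightarrow> real) \<Rightarrow> real mat" where
  "band_circ n b \<xi> = circ n (\<lambda>k. if 1 \<le> k \<and> k \<le> b then \<xi> k
                                else if n - b \<le> k \<and> k < n then \<xi> (n - k) else 0)"

definition band_toep :: "nat \<Rightarrow> nat \<Rightarrow> (nat \<Rightarrow> real) \<Rightarrow> real mat" where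
  "band_toep n b \<xi> = toep_s n (\<lambda>k. if 1 \<le> k \<and> k \<le> b then \<xi> k else 0)"

definition psd :: "complex mat \<Rightarrow> bool" where
  "psd B \<longleftrightarrow> square_mat B \<and> mat_adjoint B = B \<and>
     (\<forall>v \<in> carrier_vec (dim_row B). 0 \<le> Re ((B *\<^sub>v v) \<bullet>c v))"

text \<open>Every positive semidefinite matrix has exactly one positive semidefinite square root,
  so the description below is meaningful for such arguments, in particular for
  the product of the adjoint of a matrix with the matrix itself.\<close>

definition mat_sqrt :: "complex mat \<Rightarrow> complex mat" where
  "mat_sqrt P = (THE B. psd B \<and> B * B = P)"

definition mat_trace :: "complex mat \<Rightarrow> complex" where
  "mat_trace A = sum_list (diag_mat A)"

text \<open>The trace norm. The trace is a nonnegative real number, so taking its real part only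
  changes the type.\<close>

definition energy :: "complex mat \<Rightarrow> real" where
  "energy A = Re (mat_trace (mat_sqrt (mat_adjoint A * A)))"

abbreviation energy_real :: "real mat \<Rightarrow> real" where
  "energy_real A \<equiv> energy (map_mat complex_of_real A)"

end

theory Submission
  imports Defs "Jordan_Normal_Form.Spectral_Radius"
begin

(* Only the matrix library's notation for vector entries and dot products is meant below. *)
unbundle no vec_syntax
unbundle no inner_syntax

text \<open>
  The two band matrices differ only in the two corners, and the trace norm is insensitive to such
  a change. For a Hermitian \<open>A\<close>, the trace norm is the maximum of \<open>Re (tr (A S))\<close> over unitary
  \<open>S\<close> (lemmas \<open>trace_unitary_le_energy\<close> and \<open>energy_attained\<close>). Taking the \<open>S\<close> that attains the
  maximum for \<open>A\<close> and using it as a competitor for \<open>B\<close> gives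
  \<open>energy A - energy B \<le> Re (tr ((A - B) S))\<close>. If \<open>A - B\<close> vanishes outside the rows in a set \<open>R\<close>,
  only the columns of \<open>S\<close> with index in \<open>R\<close> enter this trace; each has norm 1, so by
  Cauchy-Schwarz it is at most \<open>sqrt (card R)\<close> times the Frobenius norm of \<open>A - B\<close>
  (lemma \<open>energy_perturbation\<close>).

  The Toeplitz and the circulant matrix differ in \<open>2 * b\<close> rows, and \<open>\<xi>\<^sub>k\<close> occurs in the
  difference exactly \<open>2 * k\<close> times, up to sign. Hence, pointwise, the energies differ by at most
  \<open>sqrt (2 * b) * sqrt (\<Sum>k=1..b. 2 * k * \<xi>\<^sub>k\<^sup>2)\<close>. Jensen's inequality moves the expectation
  under the square root, where the sum becomes \<open>b * (b + 1)\<close> times the common second moment;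
  dividing by \<open>n * sqrt b\<close> gives the first bound. The second one follows from
  \<open>E \<xi>\<^sub>k\<^sup>2 = a\<^sup>2 + \<sigma>\<^sup>2 \<le> (\<bar>a\<bar> + \<sigma>)\<^sup>2\<close> and \<open>b + 1 \<le> 2 * b\<close>.

  Two facts make the energies and their expectations computable. A Hermitian matrix has a unitary
  diagonalization \<open>U diag(l) U\<^sup>*\<close>; the positive semidefinite square root of \<open>A\<^sup>* A\<close> is then
  \<open>U diag(\<bar>l\<bar>) U\<^sup>*\<close>, and no other matrix qualifies, so the energy is the sum of the \<open>\<bar>l\<^sub>i\<bar>\<close>.
  And the energy is continuous in the entries, by the perturbation bound with \<open>R\<close> all rows,
  hence measurable, and it grows at most linearly, hence it is integrable.
\<close>

section \<open>Adjoints and traces\<close>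

lemma adjoint_carrier [simp]:
  "A \<in> carrier_mat n m \<Longrightarrow> mat_adjoint A \<in> carrier_mat m n"
  unfolding mat_adjoint_def by auto

lemma adjoint_dim [simp]:
  "dim_row (mat_adjoint A) = dim_col A" "dim_col (mat_adjoint A) = dim_row A"
  unfolding mat_adjoint_def by auto

lemma adjoint_index [simp]:
  "i < dim_col A \<Longrightarrow> j < dim_row A \<Longrightarrow> mat_adjoint A $$ (i, j) = conjugate (A $$ (j, i))"
  unfolding mat_adjoint_def by (simp add: mat_of_rows_index)

lemma adjoint_adjoint [simp]: "mat_adjoint (mat_adjoint A) = A"
  by (rule eq_matI) auto

lemma adjoint_mult:
  fixes A B :: "complex mat"
  assumes "A \<in> carrier_mat n m" "B \<in> carrier_mat m k"
  shows "mat_adjoint (A * B) = mat_adjoint B * mat_adjoint A"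
  using assms by (intro eq_matI) (auto simp: scalar_prod_def mult.commute intro!: sum.cong)

lemma adjoint_diag [simp]:
  "mat_adjoint (mat_diag n f :: complex mat) = mat_diag n (\<lambda>i. cnj (f i))"
  by (rule eq_matI) (auto simp: mat_diag_def)

lemma adjoint_cscalar_prod:
  fixes A :: "complex mat"
  assumes A: "A \<in> carrier_mat n m" and v: "v \<in> carrier_vec m" and w: "w \<in> carrier_vec n"
  shows "(A *\<^sub>v v) \<bullet>c w = v \<bullet>c (mat_adjoint A *\<^sub>v w)"
proof -
  have "(A *\<^sub>v v) \<bullet>c w = (\<Sum>i<n. \<Sum>j<m. A $$ (i, j) * v $ j * cnj (w $ i))"
    using assms by (auto simp: scalar_prod_def sum_distrib_right atLeast0LessThan intro!: sum.cong)
  also have "\<dots> = (\<Sum>j<m. \<Sum>i<n. A $$ (i, j) * v $ j * cnj (w $ i))"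
    by (rule sum.swap)
  also have "\<dots> = v \<bullet>c (mat_adjoint A *\<^sub>v w)"
    using assms by (auto simp: scalar_prod_def sum_distrib_left atLeast0LessThan mult_ac intro!: sum.cong)
  finally show ?thesis .
qed

text \<open>The inner dimension of a product is not determined by the dimensions of the result.
  For square matrices it is, which lets the simplifier check the dimensions when it reassociates.\<close>

lemma mult_carrier_square:
  "A \<in> carrier_mat n n \<Longrightarrow> B \<in> carrier_mat n n \<Longrightarrow> A * B \<in> carrier_mat n n"
  by (rule mult_carrier_mat)

lemma trace_eq_sum: "A \<in> carrier_mat n n \<Longrightarrow> mat_trace A = (\<Sum>i<n. A $$ (i, i))"
  unfolding mat_trace_def diag_mat_def by (auto simp: sum_list_sum_nth atLeast0LessThan)

lemma trace_mult_eq_sum: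
  assumes "A \<in> carrier_mat n m" "B \<in> carrier_mat m n"
  shows "mat_trace (A * B) = (\<Sum>i<n. \<Sum>j<m. A $$ (i, j) * B $$ (j, i))"
proof -
  have "A * B \<in> carrier_mat n n" using assms by auto
  then show ?thesis
    using assms by (auto simp: trace_eq_sum[of _ n] scalar_prod_def atLeast0LessThan intro!: sum.cong)
qed

lemma trace_mult_commute:
  assumes "A \<in> carrier_mat n m" "B \<in> carrier_mat m n"
  shows "mat_trace (A * B) = mat_trace (B * A)"
  unfolding trace_mult_eq_sum[OF assms] trace_mult_eq_sum[OF assms(2,1)]
  by (subst sum.swap) (simp add: mult.commute)

section \<open>Unitary diagonalization of Hermitian matrices\<close>

definition unitary :: "nat \<Rightarrow> complex mat \<Rightarrow> bool" where
  "unitary n U \<longleftrightarrow> U \<in> carrier_mat n n \<and> mat_adjoint U * U = 1\<^sub>m n"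

lemma unitaryD:
  assumes "unitary n U"
  shows "U \<in> carrier_mat n n" "mat_adjoint U \<in> carrier_mat n n"
    "mat_adjoint U * U = 1\<^sub>m n" "U * mat_adjoint U = 1\<^sub>m n"
  using assms mat_mult_left_right_inverse[of "mat_adjoint U" n U]
  unfolding unitary_def by auto

lemma unitary_adjoint: "unitary n U \<Longrightarrow> unitary n (mat_adjoint U)"
  using unitaryD[of n U] unfolding unitary_def by auto

lemma unitary_mult:
  assumes "unitary n U" "unitary n V"
  shows "unitary n (U * V)"
proof -
  note U = unitaryD[OF assms(1)] and V = unitaryD[OF assms(2)]
  have "mat_adjoint U * (U * V) = V"
    using U V by (simp add: assoc_mult_mat[of "mat_adjoint U" n n U n V n, symmetric])
  then have "mat_adjoint (U * V) * (U * V) = mat_adjoint V * V"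
    using U(1,2) V(1,2) by (simp add: adjoint_mult[of _ n n _ n] mult_carrier_square assoc_mult_mat[of _ n n _ n _ n])
  then show ?thesis using U V unfolding unitary_def by auto
qed

lemma unitary_sum_column:
  assumes "unitary n U" "i < n"
  shows "(\<Sum>j<n. (cmod (U $$ (j, i)))\<^sup>2) = 1"
proof -
  note U = unitaryD[OF assms(1)]
  have "(mat_adjoint U * U) $$ (i, i) = (\<Sum>j<n. cnj (U $$ (j, i)) * U $$ (j, i))"
    using U(1) assms(2) by (auto simp: scalar_prod_def atLeast0LessThan intro!: sum.cong)
  also have "\<dots> = complex_of_real (\<Sum>j<n. (cmod (U $$ (j, i)))\<^sup>2)"
    by (simp add: complex_norm_square mult.commute del: of_real_power)
  finally show ?thesis
    using U(3) assms(2) by (metis index_one_mat(1) of_real_eq_1_iff)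
qed

text \<open>Gram-Schmidt applied to a basis that begins with \<open>v\<close> keeps the direction of \<open>v\<close>. Its output
  is orthogonal but not normalized, so each vector \<open>ws ! j\<close> is scaled by the factor \<open>c j\<close>.\<close>

lemma unitary_with_first_column:
  fixes v :: "complex vec"
  assumes v: "v \<in> carrier_vec n" "v \<noteq> 0\<^sub>v n"
  obtains U c where "unitary n U" "col U 0 = c \<cdot>\<^sub>v v"
proof -
  interpret cof_vec_space n "TYPE(complex)" .
  define b where "b = basis_completion v"
  define ws where "ws = gram_schmidt n b"
  note bc = basis_completion[OF v, folded b_def]
  have ws: "corthogonal ws" "set ws \<subseteq> carrier_vec n" "length ws = n"
    using gram_schmidt_result[OF bc(2,4,5) ws_def] bc(6) by auto
  have n: "n > 0" using v by (cases n) auto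
  then obtain vs where "b = v # vs" using bc(6,7) by (cases b) auto
  then have hd: "ws ! 0 = v"
    using gram_schmidt_hd[OF v(1), of vs] n ws(3) unfolding ws_def
    by (metis hd_conv_nth length_0_conv less_irrefl)
  define c where "c i = complex_of_real (1 / sqrt (Re (ws ! i \<bullet>c ws ! i)))" for i
  have creal: "cnj (c i) = c i" for i by (simp add: c_def)
  define U where "U = mat n n (\<lambda>(i, j). c j * ws ! j $ i)"
  have wsn: "ws ! i \<in> carrier_vec n" if "i < n" for i using ws that by auto
  have "mat_adjoint U * U = 1\<^sub>m n"
  proof (rule eq_matI)
    fix i j assume ij: "i < dim_row (1\<^sub>m n)" "j < dim_col (1\<^sub>m n)"
    then have ij: "i < n" "j < n" by auto
    have "(mat_adjoint U * U) $$ (i, j) = (\<Sum>k<n. cnj (c i * ws ! i $ k) * (c j * ws ! j $ k))"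
      using ij unfolding U_def by (auto simp: scalar_prod_def atLeast0LessThan intro!: sum.cong)
    also have "\<dots> = c i * c j * (ws ! j \<bullet>c ws ! i)"
      using wsn[OF ij(1)] wsn[OF ij(2)] creal
      by (auto simp: scalar_prod_def sum_distrib_left mult_ac atLeast0LessThan intro!: sum.cong)
    also have "\<dots> = (if i = j then 1 else 0)"
    proof (cases "i = j")
      case True
      have ge: "ws ! i \<bullet>c ws ! i \<ge> 0" by (rule conjugate_square_ge_0_vec)
      have "ws ! i \<bullet>c ws ! i \<noteq> 0" using corthogonalD[OF ws(1)] ij ws(3) by auto
      moreover from ge have eq: "ws ! i \<bullet>c ws ! i = complex_of_real (Re (ws ! i \<bullet>c ws ! i))"
        by (simp add: complex_eq_iff less_eq_complex_def)
      ultimately have "Re (ws ! i \<bullet>c ws ! i) > 0"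
        using ge by (metis less_eq_complex_def less_le of_real_0 zero_complex.simps(1))
      then have "1 / sqrt (Re (ws ! i \<bullet>c ws ! i)) * (1 / sqrt (Re (ws ! i \<bullet>c ws ! i)))
        * Re (ws ! i \<bullet>c ws ! i) = 1" by simp
      then show ?thesis unfolding c_def True using True eq by (metis of_real_1 of_real_mult)
    next
      case False
      then show ?thesis using corthogonalD[OF ws(1)] ij ws(3) by auto
    qed
    finally show "(mat_adjoint U * U) $$ (i, j) = 1\<^sub>m n $$ (i, j)" using ij by simp
  qed (auto simp: U_def)
  then have "unitary n U" unfolding unitary_def U_def by auto
  moreover have "col U 0 = c 0 \<cdot>\<^sub>v v" using n v hd unfolding U_def by auto
  ultimately show thesis by (rule that)
qed

lemma adjoint_four_block:
  fixes A B C D :: "complex mat"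
  assumes "A \<in> carrier_mat nr1 nc1" "B \<in> carrier_mat nr1 nc2"
    "C \<in> carrier_mat nr2 nc1" "D \<in> carrier_mat nr2 nc2"
  shows "mat_adjoint (four_block_mat A B C D) =
    four_block_mat (mat_adjoint A) (mat_adjoint C) (mat_adjoint B) (mat_adjoint D)"
  using assms by (intro eq_matI) auto

text \<open>In an orthonormal basis that begins with an eigenvector, the first column of \<open>A\<close> is
  zero below the diagonal; since \<open>A\<close> is Hermitian, so is the first row beside it.\<close>

lemma hermitian_deflate:
  fixes A :: "complex mat"
  assumes A: "A \<in> carrier_mat (Suc m) (Suc m)" and herm: "mat_adjoint A = A"
  obtains U e A' where "unitary (Suc m) U" "A' \<in> carrier_mat m m" "mat_adjoint A' = A'"
    "mat_adjoint U * A * U = four_block_mat (mat 1 1 (\<lambda>_. e)) (0\<^sub>m 1 m) (0\<^sub>m m 1) A'"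
proof -
  let ?n = "Suc m"
  obtain e where "eigenvalue A e"
    using spectrum_non_empty[OF A] unfolding spectrum_def by auto
  then obtain v where v: "v \<in> carrier_vec ?n" "v \<noteq> 0\<^sub>v ?n" "A *\<^sub>v v = e \<cdot>\<^sub>v v"
    using A unfolding eigenvalue_def eigenvector_def by auto
  obtain U c where Uu: "unitary ?n U" and c: "col U 0 = c \<cdot>\<^sub>v v"
    using unitary_with_first_column[OF v(1,2)] by blast
  note U = unitaryD[OF Uu]
  define H where "H = mat_adjoint U * A * U"
  have H: "H \<in> carrier_mat ?n ?n" unfolding H_def using U A by auto
  have hermH: "mat_adjoint H = H"
    unfolding H_def using U(1,2) A herm
    by (simp add: adjoint_mult[of _ ?n ?n _ ?n] mult_carrier_square assoc_mult_mat[of _ ?n ?n _ ?n _ ?n])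
  have AU: "A *\<^sub>v col U 0 = e \<cdot>\<^sub>v col U 0"
    unfolding c using v A by (simp add: mult_mat_vec smult_smult_assoc mult.commute)
  have col0: "H $$ (i, 0) = (if i = 0 then e else 0)" if "i < ?n" for i
  proof -
    have "H = mat_adjoint U * (A * U)" unfolding H_def using A U by (intro assoc_mult_mat) auto
    then have "H $$ (i, 0) = row (mat_adjoint U) i \<bullet> col (A * U) 0"
      using that U A by simp
    also have "col (A * U) 0 = A *\<^sub>v col U 0" by (rule col_mult2[OF A U(1)]) simp
    finally have "H $$ (i, 0) = row (mat_adjoint U) i \<bullet> (A *\<^sub>v col U 0)" .
    also have "\<dots> = e * (row (mat_adjoint U) i \<bullet> col U 0)"
      unfolding AU using U(1) by (intro scalar_prod_smult_distrib[of _ ?n] carrier_vecI) auto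
    also have "row (mat_adjoint U) i \<bullet> col U 0 = (mat_adjoint U * U) $$ (i, 0)"
      using U(1) that by simp
    finally show ?thesis using U that by auto
  qed
  have row0: "H $$ (0, j) = (if j = 0 then e else 0)" if "j < ?n" for j
  proof (cases "j = 0")
    case False
    have "H $$ (0, j) = cnj (H $$ (j, 0))" using hermH H that adjoint_index[of 0 H j] by simp
    then show ?thesis using col0[OF that] False by simp
  qed (use col0[of 0] in auto)
  define A' where "A' = mat m m (\<lambda>(i, j). H $$ (Suc i, Suc j))"
  have "H = four_block_mat (mat 1 1 (\<lambda>_. e)) (0\<^sub>m 1 m) (0\<^sub>m m 1) A'"
    unfolding A'_def using H row0 col0 by (intro eq_matI) auto
  moreover have "mat_adjoint A' = A'"
  proof (rule eq_matI)
    fix i j assume "i < dim_row A'" "j < dim_col A'"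
    then have ij: "i < m" "j < m" unfolding A'_def by auto
    then have "H $$ (Suc i, Suc j) = cnj (H $$ (Suc j, Suc i))"
      using hermH H adjoint_index[of "Suc i" H "Suc j"] by simp
    then show "mat_adjoint A' $$ (i, j) = A' $$ (i, j)" using ij unfolding A'_def by simp
  qed (auto simp: A'_def)
  moreover have "A' \<in> carrier_mat m m" unfolding A'_def by auto
  ultimately show thesis using that[OF Uu] unfolding H_def by blast
qed

text \<open>Repeated deflation gives \<open>U\<^sup>* A U\<close> diagonal. This matrix is Hermitian, so its
  entries are real.\<close>

theorem hermitian_diagonalization:
  fixes A :: "complex mat"
  assumes "A \<in> carrier_mat n n" "mat_adjoint A = A"
  obtains U and l :: "nat \<Rightarrow> real" where "unitary n U"
    "A = U * mat_diag n (\<lambda>i. of_real (l i)) * mat_adjoint U"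
proof -
  have "\<exists>U d. unitary n U \<and> mat_adjoint U * A * U = mat_diag n d"
    using assms
  proof (induction n arbitrary: A)
    case 0
    then show ?case
      by (intro exI[of _ "1\<^sub>m 0"] exI[of _ "\<lambda>_. 0"] conjI eq_matI) (auto simp: unitary_def mat_diag_def)
  next
    case (Suc m)
    let ?n = "Suc m"
    from hermitian_deflate[OF Suc.prems] obtain U e A' where
      Uu: "unitary ?n U" and A': "A' \<in> carrier_mat m m" "mat_adjoint A' = A'" and
      H: "mat_adjoint U * A * U = four_block_mat (mat 1 1 (\<lambda>_. e)) (0\<^sub>m 1 m) (0\<^sub>m m 1) A'"
      by metis
    from Suc.IH[OF A'] obtain V d where Vu: "unitary m V" and Vd: "mat_adjoint V * A' * V = mat_diag m d"
      by blast
    note U = unitaryD[OF Uu] and V = unitaryD[OF Vu]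
    let ?E = "mat 1 1 (\<lambda>_. e)"
    define W where "W = four_block_mat (1\<^sub>m 1) (0\<^sub>m 1 m) (0\<^sub>m m 1) V"
    have W: "W \<in> carrier_mat ?n ?n" unfolding W_def using V by auto
    have adjW: "mat_adjoint W = four_block_mat (1\<^sub>m 1) (0\<^sub>m 1 m) (0\<^sub>m m 1) (mat_adjoint V)"
    proof -
      have "mat_adjoint (0\<^sub>m k l) = (0\<^sub>m l k :: complex mat)" for k l by (rule eq_matI) auto
      then show ?thesis
        unfolding W_def using V by (subst adjoint_four_block[of _ 1 1 _ m _ m]) auto
    qed
    have Wu: "unitary ?n W"
      unfolding unitary_def adjW unfolding W_def using V
      by (auto simp: mult_four_block_mat[of _ 1 1 _ m _ m _ _ 1 _ m])
    have "mat_adjoint (U * W) * A * (U * W) = mat_adjoint W * (mat_adjoint U * A * U) * W"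
      using U(1,2) W Suc.prems(1)
      by (simp add: adjoint_mult[of _ ?n ?n _ ?n] mult_carrier_square assoc_mult_mat[of _ ?n ?n _ ?n _ ?n])
    also have "\<dots> = four_block_mat ?E (0\<^sub>m 1 m) (0\<^sub>m m 1) (mat_diag m d)"
    proof -
      have "mat_adjoint W * (mat_adjoint U * A * U)
        = four_block_mat ?E (0\<^sub>m 1 m) (0\<^sub>m m 1) (mat_adjoint V * A')"
        unfolding H adjW using V A' by (subst mult_four_block_mat[of _ 1 1 _ m _ m _ _ 1 _ m]) auto
      also have "\<dots> * W = four_block_mat ?E (0\<^sub>m 1 m) (0\<^sub>m m 1) (mat_adjoint V * A' * V)"
        unfolding W_def using V A' by (subst mult_four_block_mat[of _ 1 1 _ m _ m _ _ 1 _ m]) auto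
      finally show ?thesis unfolding Vd .
    qed
    also have "\<dots> = mat_diag ?n (\<lambda>i. if i = 0 then e else d (i - 1))"
      by (rule eq_matI) (auto simp: mat_diag_def)
    finally show ?case using unitary_mult[OF Uu Wu] by blast
  qed
  then obtain U d where Uu: "unitary n U" and d: "mat_adjoint U * A * U = mat_diag n d" by blast
  note U = unitaryD[OF Uu]
  have "mat_adjoint (mat_diag n d) = mat_diag n d"
    unfolding d[symmetric] using U(1,2) assms
    by (simp add: adjoint_mult[of _ n n _ n] mult_carrier_square assoc_mult_mat[of _ n n _ n _ n])
  then have eq: "mat_diag n (\<lambda>i. cnj (d i)) $$ (i, i) = mat_diag n d $$ (i, i)" for i by simp
  have "d i = of_real (Re (d i))" if "i < n" for i
    using eq[of i] that by (simp add: mat_diag_def complex_eq_iff)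
  then have "mat_diag n d = mat_diag n (\<lambda>i. of_real (Re (d i)))"
    by (intro eq_matI) (auto simp: mat_diag_def)
  moreover have "U * mat_diag n d * mat_adjoint U = A"
  proof -
    have "U * mat_diag n d * mat_adjoint U = (U * mat_adjoint U) * A * (U * mat_adjoint U)"
      unfolding d[symmetric] using U(1,2) assms(1)
      by (simp add: mult_carrier_square assoc_mult_mat[of _ n n _ n _ n])
    then show ?thesis using U assms(1) by simp
  qed
  ultimately show thesis using that[OF Uu] by metis
qed

section \<open>The trace norm through the spectral decomposition\<close>

text \<open>For a fixed orthonormal basis \<open>U\<close>, this is the functional calculus: products of such
  matrices are computed pointwise on the eigenvalues \<open>f\<close>, which yields squares, square roots and
  signs of a Hermitian matrix.\<close>

definition from_spectrum :: "nat \<Rightarrow> complex mat \<Rightarrow> (nat \<Rightarrow> real) \<Rightarrow> complex mat" where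
  "from_spectrum n U f = U * mat_diag n (\<lambda>i. of_real (f i)) * mat_adjoint U"

lemma from_spectrum_carrier:
  "unitary n U \<Longrightarrow> from_spectrum n U f \<in> carrier_mat n n"
  using unitaryD[of n U] unfolding from_spectrum_def by auto

lemma from_spectrum_mult:
  assumes "unitary n U"
  shows "from_spectrum n U f * from_spectrum n U g = from_spectrum n U (\<lambda>i. f i * g i)"
proof -
  note U = unitaryD[OF assms]
  let ?D = "\<lambda>f. mat_diag n (\<lambda>i. complex_of_real (f i))"
  have "mat_adjoint U * (U * (?D g * mat_adjoint U)) = ?D g * mat_adjoint U"
    using U by (simp add: assoc_mult_mat[of "mat_adjoint U" n n U n "?D g * mat_adjoint U" n, symmetric]
        mult_carrier_square left_mult_one_mat[of _ n n])
  then have "from_spectrum n U f * from_spectrum n U g = U * (?D f * (?D g * mat_adjoint U))"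
    using U(1) unfolding from_spectrum_def
    by (simp add: mult_carrier_square assoc_mult_mat[of _ n n _ n _ n])
  also have "\<dots> = U * (?D f * ?D g) * mat_adjoint U"
    using U(1) by (simp add: mult_carrier_square assoc_mult_mat[of _ n n _ n _ n] del: mat_diag_diag)
  finally show ?thesis unfolding from_spectrum_def by simp
qed

lemma from_spectrum_adjoint:
  assumes "unitary n U"
  shows "mat_adjoint (from_spectrum n U f) = from_spectrum n U f"
  using unitaryD[OF assms] unfolding from_spectrum_def
  by (simp add: mult_carrier_square assoc_mult_mat[of _ n n _ n _ n] adjoint_mult[of _ n n _ n])

lemma from_spectrum_col:
  assumes "unitary n U" "i < n"
  shows "from_spectrum n U f *\<^sub>v col U i = of_real (f i) \<cdot>\<^sub>v col U i"
proof -
  note U = unitaryD[OF assms(1)]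
  let ?D = "mat_diag n (\<lambda>i. complex_of_real (f i))"
  have F: "from_spectrum n U f * U = U * ?D"
    using U unfolding from_spectrum_def
    by (simp add: mult_carrier_square right_mult_one_mat[OF mat_diag_dim] assoc_mult_mat[of _ n n _ n _ n])
  have "from_spectrum n U f *\<^sub>v col U i = col (from_spectrum n U f * U) i"
    using col_mult2[OF from_spectrum_carrier[OF assms(1)] U(1) assms(2)] by simp
  also have "\<dots> = of_real (f i) \<cdot>\<^sub>v col U i"
    unfolding F using U(1) assms(2) by (intro eq_vecI) (auto simp: mat_diag_mult_right[OF U(1)])
  finally show ?thesis .
qed

text \<open>The trace is computed in the eigenbasis: cyclicity moves \<open>U\<close> to the other side.\<close>

lemma trace_from_spectrum_mult:
  assumes "unitary n U" "T \<in> carrier_mat n n"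
  shows "mat_trace (from_spectrum n U f * T) = (\<Sum>i<n. of_real (f i) * (mat_adjoint U * T * U) $$ (i, i))"
proof -
  note U = unitaryD[OF assms(1)]
  let ?D = "mat_diag n (\<lambda>i. complex_of_real (f i))"
  have "mat_trace (from_spectrum n U f * T) = mat_trace (U * (?D * (mat_adjoint U * T)))"
    using U(1) assms(2) unfolding from_spectrum_def
    by (simp add: mult_carrier_square assoc_mult_mat[of _ n n _ n _ n])
  also have "\<dots> = mat_trace (?D * (mat_adjoint U * T) * U)"
    using U(1) assms(2) by (intro trace_mult_commute[of _ n n]) (auto simp: mult_carrier_square)
  also have "?D * (mat_adjoint U * T) * U = ?D * (mat_adjoint U * T * U)"
    using U(1) assms(2) by (simp add: mult_carrier_square assoc_mult_mat[of _ n n _ n _ n])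
  also have "mat_trace \<dots> = (\<Sum>i<n. of_real (f i) * (mat_adjoint U * T * U) $$ (i, i))"
  proof -
    have "mat_adjoint U * T * U \<in> carrier_mat n n"
      using U(1) assms(2) by (simp add: mult_carrier_square)
    then show ?thesis
      by (simp add: mat_diag_mult_left[of _ n n] trace_eq_sum[of _ n] del: index_mult_mat)
  qed
  finally show ?thesis .
qed

lemma trace_from_spectrum:
  assumes "unitary n U"
  shows "mat_trace (from_spectrum n U f) = (\<Sum>i<n. of_real (f i))"
proof -
  note U = unitaryD[OF assms]
  have "mat_trace (from_spectrum n U f) = mat_trace (from_spectrum n U f * 1\<^sub>m n)"
    using from_spectrum_carrier[OF assms, of f] by simp
  also have "\<dots> = (\<Sum>i<n. of_real (f i))"
    using U by (subst trace_from_spectrum_mult[OF assms]) (auto simp del: index_mult_mat)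
  finally show ?thesis .
qed

text \<open>The matrix is the square of the Hermitian matrix \<open>R\<close> with eigenvalues \<open>sqrt (f i)\<close>, so its
  quadratic form at \<open>v\<close> is the squared norm of \<open>R v\<close>.\<close>

lemma psd_from_spectrum:
  assumes "unitary n U" "\<And>i. i < n \<Longrightarrow> 0 \<le> f i"
  shows "psd (from_spectrum n U f)"
proof -
  let ?F = "from_spectrum n U f" and ?R = "from_spectrum n U (\<lambda>i. sqrt (f i))"
  have F: "?F \<in> carrier_mat n n" and R: "?R \<in> carrier_mat n n"
    using from_spectrum_carrier[OF assms(1)] by auto
  have "?F = ?R * ?R"
  proof -
    have "mat_diag n (\<lambda>i. complex_of_real (f i)) = mat_diag n (\<lambda>i. of_real (sqrt (f i) * sqrt (f i)))"
      using assms(2) by (intro eq_matI) (auto simp: mat_diag_def simp flip: of_real_mult)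
    then show ?thesis unfolding from_spectrum_mult[OF assms(1)] unfolding from_spectrum_def by simp
  qed
  have "0 \<le> Re ((?F *\<^sub>v v) \<bullet>c v)" if v: "v \<in> carrier_vec n" for v
  proof -
    have Rv: "?R *\<^sub>v v \<in> carrier_vec n" using R v by auto
    have "(?F *\<^sub>v v) \<bullet>c v = (?R *\<^sub>v (?R *\<^sub>v v)) \<bullet>c v"
      unfolding \<open>?F = ?R * ?R\<close> using R v by (simp add: assoc_mult_mat_vec[of _ n n _ n])
    also have "\<dots> = (?R *\<^sub>v v) \<bullet>c (?R *\<^sub>v v)"
      using adjoint_cscalar_prod[OF R Rv v] by (simp add: from_spectrum_adjoint[OF assms(1)])
    also have "\<dots> \<ge> 0" by (rule conjugate_square_ge_0_vec)
    finally show ?thesis by (simp add: less_eq_complex_def)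
  qed
  then show ?thesis
    unfolding psd_def using F from_spectrum_adjoint[OF assms(1)] by auto
qed

text \<open>This is what makes the square root unique. The hypothesis says \<open>(B + f) (B - f) u = 0\<close>, so
  \<open>w = (B - f) u\<close> satisfies \<open>B w = - f w\<close>. If \<open>f > 0\<close>, positivity of \<open>B\<close> forces \<open>w = 0\<close>. If
  \<open>f = 0\<close>, then \<open>w = B u\<close>, and the squared norm of \<open>B u\<close> is the inner product of \<open>B (B u) = 0\<close>
  with \<open>u\<close>.\<close>

lemma psd_sqrt_eigenvector:
  fixes B :: "complex mat"
  assumes B: "B \<in> carrier_mat n n" "psd B" and u: "u \<in> carrier_vec n"
    and f: "0 \<le> f" and BB: "B *\<^sub>v (B *\<^sub>v u) = of_real (f * f) \<cdot>\<^sub>v u"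
  shows "B *\<^sub>v u = of_real f \<cdot>\<^sub>v u"
proof -
  have herm: "mat_adjoint B = B" and nonneg: "\<And>v. v \<in> carrier_vec n \<Longrightarrow> 0 \<le> Re ((B *\<^sub>v v) \<bullet>c v)"
    using B unfolding psd_def by auto
  have Bu: "B *\<^sub>v u \<in> carrier_vec n" using B u by auto
  define w where "w = B *\<^sub>v u - of_real f \<cdot>\<^sub>v u"
  have w: "w \<in> carrier_vec n" unfolding w_def using Bu u by auto
  have ww: "0 \<le> w \<bullet>c w" by (rule conjugate_square_ge_0_vec)
  have "w = 0\<^sub>v n"
  proof (cases "f = 0")
    case True
    have weq: "w = B *\<^sub>v u"
      unfolding w_def True using Bu u B(1) by (intro eq_vecI) (auto simp del: index_mult_mat_vec)
    have "w \<bullet>c w = (B *\<^sub>v w) \<bullet>c u"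
      unfolding weq using adjoint_cscalar_prod[OF B(1) Bu u] herm by simp
    also have "B *\<^sub>v w = 0\<^sub>v n" unfolding weq BB True using u by (intro eq_vecI) auto
    finally show ?thesis using w u by (simp add: conjugate_square_eq_0_vec)
  next
    case False
    have "B *\<^sub>v w = B *\<^sub>v (B *\<^sub>v u) - of_real f \<cdot>\<^sub>v (B *\<^sub>v u)"
      unfolding w_def using B(1) u Bu
      by (simp add: mult_minus_distrib_mat_vec[of _ n n] mult_mat_vec[of _ n n])
    also have "\<dots> = - of_real f \<cdot>\<^sub>v w"
      unfolding BB w_def using B(1) u Bu
      by (intro eq_vecI) (auto simp: algebra_simps simp del: index_mult_mat_vec)
    finally have "(B *\<^sub>v w) \<bullet>c w = - of_real f * (w \<bullet>c w)"
      using w by simp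
    then have "f * Re (w \<bullet>c w) \<le> 0" using nonneg[OF w] by simp
    then have "Re (w \<bullet>c w) \<le> 0" using f False by (simp add: mult_le_0_iff)
    then have "w \<bullet>c w = 0" using ww by (simp add: less_eq_complex_def complex_eq_iff)
    then show ?thesis using w by (simp add: conjugate_square_eq_0_vec)
  qed
  then have "w $ i = 0" if "i < n" for i using that by simp
  then show ?thesis
    using Bu u B(1) unfolding w_def by (intro eq_vecI) (auto simp del: index_mult_mat_vec)
qed

text \<open>Any positive semidefinite square root agrees with the expected one on every column of \<open>U\<close>,
  and these columns form a basis.\<close>

lemma mat_sqrt_from_spectrum:
  assumes U: "unitary n U" and f: "\<And>i. i < n \<Longrightarrow> 0 \<le> f i"
  shows "mat_sqrt (from_spectrum n U (\<lambda>i. f i * f i)) = from_spectrum n U f"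
  unfolding mat_sqrt_def
proof (rule the_equality)
  show "psd (from_spectrum n U f) \<and>
    from_spectrum n U f * from_spectrum n U f = from_spectrum n U (\<lambda>i. f i * f i)"
    using psd_from_spectrum[OF U f] from_spectrum_mult[OF U] by simp
next
  fix B assume "psd B \<and> B * B = from_spectrum n U (\<lambda>i. f i * f i)"
  then have Bp: "psd B" and BB: "B * B = from_spectrum n U (\<lambda>i. f i * f i)" by auto
  note Ud = unitaryD[OF U]
  let ?F = "from_spectrum n U f"
  have "dim_row B = dim_row (B * B)" "dim_col B = dim_col (B * B)" by auto
  then have B: "B \<in> carrier_mat n n"
    unfolding BB using from_spectrum_carrier[OF U, of "\<lambda>i. f i * f i"] by auto
  have F: "?F \<in> carrier_mat n n" by (rule from_spectrum_carrier[OF U])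
  have col: "B *\<^sub>v col U i = ?F *\<^sub>v col U i" if i: "i < n" for i
  proof -
    have u: "col U i \<in> carrier_vec n" using Ud(1) by (intro carrier_vecI) auto
    have "B *\<^sub>v (B *\<^sub>v col U i) = (B * B) *\<^sub>v col U i"
      using B u by (simp add: assoc_mult_mat_vec[of _ n n _ n])
    then have "B *\<^sub>v (B *\<^sub>v col U i) = of_real (f i * f i) \<cdot>\<^sub>v col U i"
      unfolding BB using from_spectrum_col[OF U i] by simp
    then show ?thesis
      using psd_sqrt_eigenvector[OF B Bp u f[OF i]] from_spectrum_col[OF U i] by simp
  qed
  have "B * U = ?F * U"
  proof (rule mat_col_eqI)
    fix i assume "i < dim_col (?F * U)"
    then have i: "i < n" using Ud(1) by simp
    show "col (B * U) i = col (?F * U) i"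
      using col[OF i] col_mult2[OF B Ud(1) i] col_mult2[OF F Ud(1) i] by simp
  qed (use B F in auto)
  then have "B * U * mat_adjoint U = ?F * U * mat_adjoint U" by simp
  then show "B = ?F"
    using B F Ud by (simp add: assoc_mult_mat[of _ n n _ n _ n])
qed

lemma energy_from_spectrum:
  assumes "unitary n U"
  shows "energy (from_spectrum n U f) = (\<Sum>i<n. \<bar>f i\<bar>)"
proof -
  have "mat_adjoint (from_spectrum n U f) * from_spectrum n U f
    = from_spectrum n U (\<lambda>i. \<bar>f i\<bar> * \<bar>f i\<bar>)"
    using assms by (simp add: from_spectrum_adjoint from_spectrum_mult)
  then have "mat_sqrt (mat_adjoint (from_spectrum n U f) * from_spectrum n U f)
    = from_spectrum n U (\<lambda>i. \<bar>f i\<bar>)"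
    using mat_sqrt_from_spectrum[OF assms, of "\<lambda>i. \<bar>f i\<bar>"] by simp
  then show ?thesis unfolding energy_def by (simp add: trace_from_spectrum[OF assms])
qed

lemma unitary_entry_le_1:
  assumes "unitary n U" "i < n" "j < n"
  shows "cmod (U $$ (j, i)) \<le> 1"
proof -
  have "(cmod (U $$ (j, i)))\<^sup>2 \<le> (\<Sum>j<n. (cmod (U $$ (j, i)))\<^sup>2)"
    using assms(3) by (intro member_le_sum) auto
  then show ?thesis using unitary_sum_column[OF assms(1,2)] by (simp add: power_le_one_iff abs_square_le_1)
qed

text \<open>In the eigenbasis of \<open>A\<close> the trace is \<open>\<Sum>i. l i * V\<^sub>i\<^sub>i\<close> with the unitary matrix
  \<open>V = U\<^sup>* T U\<close>, whose entries have modulus at most 1.\<close>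

theorem trace_unitary_le_energy:
  assumes A: "A \<in> carrier_mat n n" "mat_adjoint A = A" and T: "unitary n T"
  shows "Re (mat_trace (A * T)) \<le> energy A"
proof -
  obtain U l where U: "unitary n U" and "A = U * mat_diag n (\<lambda>i. of_real (l i)) * mat_adjoint U"
    using hermitian_diagonalization[OF A] by metis
  then have Aeq: "A = from_spectrum n U l" unfolding from_spectrum_def by simp
  let ?V = "mat_adjoint U * T * U"
  have V: "unitary n ?V" by (intro unitary_mult unitary_adjoint U T)
  have "Re (mat_trace (A * T)) = (\<Sum>i<n. l i * Re (?V $$ (i, i)))"
    unfolding Aeq trace_from_spectrum_mult[OF U unitaryD(1)[OF T]] by simp
  also have "\<dots> \<le> (\<Sum>i<n. \<bar>l i\<bar> * 1)"
  proof (rule sum_mono)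
    fix i assume "i \<in> {..<n}"
    then have "\<bar>Re (?V $$ (i, i))\<bar> \<le> 1"
      using unitary_entry_le_1[OF V, of i i] abs_Re_le_cmod order_trans by blast
    then have "\<bar>l i\<bar> * \<bar>Re (?V $$ (i, i))\<bar> \<le> \<bar>l i\<bar> * 1" by (intro mult_left_mono) auto
    then show "l i * Re (?V $$ (i, i)) \<le> \<bar>l i\<bar> * 1"
      by (metis abs_ge_self abs_mult order_trans)
  qed
  finally show ?thesis unfolding Aeq energy_from_spectrum[OF U] by simp
qed

text \<open>The maximizer is the sign of \<open>A\<close>: the matrix with the same eigenvectors and the
  eigenvalues replaced by their signs.\<close>

theorem energy_attained:
  assumes A: "A \<in> carrier_mat n n" "mat_adjoint A = A"
  obtains S where "unitary n S" "energy A = Re (mat_trace (A * S))"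
proof -
  obtain U l where U: "unitary n U" and "A = U * mat_diag n (\<lambda>i. of_real (l i)) * mat_adjoint U"
    using hermitian_diagonalization[OF A] by metis
  then have Aeq: "A = from_spectrum n U l" unfolding from_spectrum_def by simp
  (* The kernel of A gets the sign 1, since the sign matrix has to be unitary. *)
  let ?s = "\<lambda>i. if l i < 0 then - 1 else 1 :: real"
  have ss: "(\<lambda>i. ?s i * ?s i) = (\<lambda>i. 1)" and ls: "(\<lambda>i. l i * ?s i) = (\<lambda>i. \<bar>l i\<bar>)" by auto
  define S where "S = from_spectrum n U ?s"
  have "mat_adjoint S * S = from_spectrum n U (\<lambda>i. 1)"
    unfolding S_def from_spectrum_adjoint[OF U] from_spectrum_mult[OF U] ss ..
  also have "\<dots> = 1\<^sub>m n" using unitaryD[OF U] unfolding from_spectrum_def by simp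
  finally have "unitary n S" unfolding unitary_def S_def using from_spectrum_carrier[OF U] by simp
  moreover have "energy A = Re (mat_trace (A * S))"
    unfolding Aeq S_def from_spectrum_mult[OF U] ls energy_from_spectrum[OF U] trace_from_spectrum[OF U]
    by simp
  ultimately show thesis by (rule that)
qed

section \<open>Perturbation of the trace norm\<close>

definition frobenius :: "complex mat \<Rightarrow> real" where
  "frobenius A = sqrt (\<Sum>(i, j)\<in>{..<dim_row A} \<times> {..<dim_col A}. (cmod (A $$ (i, j)))\<^sup>2)"

text \<open>Cauchy-Schwarz on the index set \<open>R \<times> {..<n}\<close>, where the entries of \<open>D\<close> live. The entries
  of \<open>S\<close> that they meet fill \<open>card R\<close> columns, each of norm 1.\<close>

lemma trace_mult_unitary_le_frobenius:
  fixes D :: "complex mat"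
  assumes D: "D \<in> carrier_mat n n" and S: "unitary n S" and R: "R \<subseteq> {..<n}"
    and zero: "\<And>i j. i < n \<Longrightarrow> i \<notin> R \<Longrightarrow> j < n \<Longrightarrow> D $$ (i, j) = 0"
  shows "Re (mat_trace (D * S)) \<le> sqrt (card R) * frobenius D"
proof -
  note Sd = unitaryD[OF S]
  have fin: "finite R" using R finite_subset by blast
  let ?d = "\<lambda>(i, j). cmod (D $$ (i, j))" and ?s = "\<lambda>(i, j). cmod (S $$ (j, i))"
  have "mat_trace (D * S) = (\<Sum>i<n. \<Sum>j<n. D $$ (i, j) * S $$ (j, i))"
    by (rule trace_mult_eq_sum[OF D Sd(1)])
  also have "\<dots> = (\<Sum>i\<in>R. \<Sum>j<n. D $$ (i, j) * S $$ (j, i))"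
    using R zero by (intro sum.mono_neutral_right) auto
  also have "\<dots> = (\<Sum>(i, j)\<in>R \<times> {..<n}. D $$ (i, j) * S $$ (j, i))"
    using fin by (simp add: sum.cartesian_product)
  finally have "Re (mat_trace (D * S)) \<le> cmod (\<Sum>(i, j)\<in>R \<times> {..<n}. D $$ (i, j) * S $$ (j, i))"
    by (metis complex_Re_le_cmod)
  also have "\<dots> \<le> (\<Sum>p\<in>R \<times> {..<n}. cmod (case p of (i, j) \<Rightarrow> D $$ (i, j) * S $$ (j, i)))"
    by (rule norm_sum)
  also have "\<dots> = (\<Sum>p\<in>R \<times> {..<n}. \<bar>?d p\<bar> * \<bar>?s p\<bar>)"
    by (intro sum.cong) (auto simp: norm_mult)
  also have "\<dots> \<le> L2_set ?d (R \<times> {..<n}) * L2_set ?s (R \<times> {..<n})"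
    by (rule L2_set_mult_ineq)
  also have "L2_set ?s (R \<times> {..<n}) = sqrt (\<Sum>i\<in>R. \<Sum>j<n. (cmod (S $$ (j, i)))\<^sup>2)"
    unfolding L2_set_def using fin by (simp add: sum.cartesian_product case_prod_unfold)
  also have "(\<Sum>i\<in>R. \<Sum>j<n. (cmod (S $$ (j, i)))\<^sup>2) = card R"
    using R unitary_sum_column[OF S] by (subst sum.cong[OF refl, of _ _ "\<lambda>_. 1"]) auto
  also have "L2_set ?d (R \<times> {..<n}) \<le> frobenius D"
    unfolding L2_set_def frobenius_def using D R
    by (auto simp: case_prod_unfold intro!: sum_mono2)
  finally show ?thesis by (simp add: mult.commute mult_right_mono)
qed

text \<open>The competitor argument, used in both directions. Compared with the general bound of the trace
  norm by the square root of the rank times the Frobenius norm, it replaces the rank by the number of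
  nonzero rows and so avoids singular values of \<open>A - B\<close>.\<close>

theorem energy_perturbation:
  fixes A B :: "complex mat"
  assumes A: "A \<in> carrier_mat n n" "mat_adjoint A = A" and B: "B \<in> carrier_mat n n" "mat_adjoint B = B"
    and R: "R \<subseteq> {..<n}"
    and eq: "\<And>i j. i < n \<Longrightarrow> i \<notin> R \<Longrightarrow> j < n \<Longrightarrow> A $$ (i, j) = B $$ (i, j)"
  shows "\<bar>energy A - energy B\<bar> \<le> sqrt (card R) * frobenius (A - B)"
proof -
  have le: "energy A - energy B \<le> sqrt (card R) * frobenius (A - B)"
    if A: "A \<in> carrier_mat n n" "mat_adjoint A = A" and B: "B \<in> carrier_mat n n" "mat_adjoint B = B"
      and eq: "\<And>i j. i < n \<Longrightarrow> i \<notin> R \<Longrightarrow> j < n \<Longrightarrow> A $$ (i, j) = B $$ (i, j)"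
    for A B :: "complex mat"
  proof -
    obtain S where S: "unitary n S" and eA: "energy A = Re (mat_trace (A * S))"
      using energy_attained[OF A] by blast
    have "mat_trace ((A - B) * S) = mat_trace (A * S) - mat_trace (B * S)"
      using A(1) B(1) unitaryD(1)[OF S]
      by (simp add: trace_mult_eq_sum[of _ n n] minus_carrier_mat left_diff_distrib sum_subtractf)
    then have "energy A - energy B \<le> Re (mat_trace ((A - B) * S))"
      using trace_unitary_le_energy[OF B S] unfolding eA by simp
    also have "\<dots> \<le> sqrt (card R) * frobenius (A - B)"
      using A B eq R by (intro trace_mult_unitary_le_frobenius[OF _ S]) auto
    finally show ?thesis .
  qed
  have "frobenius (B - A) = frobenius (A - B)"
    unfolding frobenius_def using A B by (auto simp: norm_minus_commute intro!: sum.cong)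
  then show ?thesis using le[OF A B] le[OF B A] eq by (simp add: abs_le_iff)
qed

section \<open>Symmetric real matrices\<close>

lemma energy_real_perturbation:
  fixes A B :: "real mat"
  assumes A: "A \<in> carrier_mat n n" and B: "B \<in> carrier_mat n n"
    and symA: "\<And>i j. i < n \<Longrightarrow> j < n \<Longrightarrow> A $$ (i, j) = A $$ (j, i)"
    and symB: "\<And>i j. i < n \<Longrightarrow> j < n \<Longrightarrow> B $$ (i, j) = B $$ (j, i)"
    and R: "R \<subseteq> {..<n}"
    and eq: "\<And>i j. i < n \<Longrightarrow> i \<notin> R \<Longrightarrow> j < n \<Longrightarrow> A $$ (i, j) = B $$ (i, j)"
  shows "\<bar>energy_real A - energy_real B\<bar>
    \<le> sqrt (card R) * sqrt (\<Sum>i<n. \<Sum>j<n. (A $$ (i, j) - B $$ (i, j))\<^sup>2)"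
proof -
  let ?c = "map_mat complex_of_real"
  have adj: "mat_adjoint (?c X) = ?c X"
    if "X \<in> carrier_mat n n" "\<And>i j. i < n \<Longrightarrow> j < n \<Longrightarrow> X $$ (i, j) = X $$ (j, i)" for X
    using that by (intro eq_matI) auto
  have "frobenius (?c A - ?c B) = sqrt (\<Sum>i<n. \<Sum>j<n. (A $$ (i, j) - B $$ (i, j))\<^sup>2)"
    unfolding frobenius_def sum.cartesian_product using A B
    by (auto simp: norm_of_real simp flip: of_real_diff intro!: sum.cong arg_cong[where f = sqrt])
  then show ?thesis
    using energy_perturbation[of "?c A" n "?c B" R] adj[OF A symA] adj[OF B symB] A B R eq by auto
qed

text \<open>With \<open>R\<close> all rows, the perturbation bound is a Lipschitz estimate.\<close>

lemma continuous_energy_real: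
  fixes F :: "'a::topological_space \<Rightarrow> real mat"
  assumes carrier: "\<And>x. F x \<in> carrier_mat n n"
    and sym: "\<And>x i j. i < n \<Longrightarrow> j < n \<Longrightarrow> F x $$ (i, j) = F x $$ (j, i)"
    and cont: "\<And>i j. i < n \<Longrightarrow> j < n \<Longrightarrow> continuous_on UNIV (\<lambda>x. F x $$ (i, j))"
  shows "continuous_on UNIV (\<lambda>x. energy_real (F x))"
  unfolding continuous_on_def
proof
  fix x :: 'a
  have tend: "((\<lambda>y. F y $$ (i, j)) \<longlongrightarrow> F x $$ (i, j)) (at x)" if "i < n" "j < n" for i j
    using cont[OF that] by (simp add: continuous_on_def)
  have "((\<lambda>y. sqrt n * sqrt (\<Sum>i<n. \<Sum>j<n. (F y $$ (i, j) - F x $$ (i, j))\<^sup>2)) \<longlongrightarrow>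
    sqrt n * sqrt (\<Sum>i<n. \<Sum>j<n. (F x $$ (i, j) - F x $$ (i, j))\<^sup>2)) (at x)"
    by (intro tendsto_intros tend) auto
  then have lim: "((\<lambda>y. sqrt n * sqrt (\<Sum>i<n. \<Sum>j<n. (F y $$ (i, j) - F x $$ (i, j))\<^sup>2)) \<longlongrightarrow> 0) (at x)"
    by simp
  have "norm (energy_real (F y) - energy_real (F x))
      \<le> sqrt n * sqrt (\<Sum>i<n. \<Sum>j<n. (F y $$ (i, j) - F x $$ (i, j))\<^sup>2)" for y
    using energy_real_perturbation[OF carrier[of y] carrier[of x] sym sym, of "{..<n}"] by auto
  then have "((\<lambda>y. energy_real (F y) - energy_real (F x)) \<longlongrightarrow> 0) (at x)"
    by (intro Lim_null_comparison[OF always_eventually lim]) auto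
  then show "((\<lambda>y. energy_real (F y)) \<longlongrightarrow> energy_real (F x)) (at x within UNIV)"
    by (simp add: LIM_zero_iff)
qed

text \<open>The integral of a non-integrable function is \<open>0\<close> by convention, so without integrability an
  expectation of an energy would carry no information. Measurability comes from continuity:
  the energy is written as a continuous function on the countable product \<open>nat \<Rightarrow> real\<close>, whose
  Borel sets are generated by the coordinates. The dominating function comes from the perturbation
  bound against the zero matrix.\<close>

lemma integrable_energy_real:
  fixes F :: "'w \<Rightarrow> real mat"
  assumes "prob_space M"
    and carrier: "\<And>w. F w \<in> carrier_mat n n"
    and sym: "\<And>w i j. i < n \<Longrightarrow> j < n \<Longrightarrow> F w $$ (i, j) = F w $$ (j, i)"
    and int: "\<And>i j. i < n \<Longrightarrow> j < n \<Longrightarrow> integrable M (\<lambda>w. F w $$ (i, j))"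
  shows "integrable M (\<lambda>w. energy_real (F w))"
proof -
  interpret prob_space M by fact
  (* e lists the entries of F row by row; G rebuilds the matrix from the entries on and above the
     diagonal only, so that it is symmetric for every argument, as the continuity lemma demands. *)
  let ?e = "\<lambda>w p. if p < n * n then F w $$ (p div n, p mod n) else 0"
  let ?G = "\<lambda>x :: nat \<Rightarrow> real. mat n n (\<lambda>(i, j). x (min i j * n + max i j))"
  have "continuous_on UNIV (\<lambda>x. energy_real (?G x))"
  proof (rule continuous_energy_real[of _ n])
    fix i j assume "i < n" "j < n"
    then show "continuous_on UNIV (\<lambda>x. ?G x $$ (i, j))"
      by (simp add: continuous_on_product_coordinates)
  qed (auto simp: min.commute max.commute)
  then have G: "(\<lambda>x. energy_real (?G x)) \<in> borel_measurable borel"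
    by (rule borel_measurable_continuous_onI)
  have "?e \<in> borel_measurable M"
  proof (rule measurable_coordinatewise_then_product)
    fix p
    show "(\<lambda>w. ?e w p) \<in> borel_measurable M"
    proof (cases "p < n * n")
      case True
      then have "p div n < n" "p mod n < n"
        by (auto simp: less_mult_imp_div_less intro!: mod_less_divisor gr0I)
      then show ?thesis using int True by auto
    qed simp
  qed
  from measurable_compose[OF this G]
  have "(\<lambda>w. energy_real (?G (?e w))) \<in> borel_measurable M" .
  moreover have "?G (?e w) = F w" for w
  proof (rule eq_matI)
    fix i j assume "i < dim_row (F w)" "j < dim_col (F w)"
    then have ij: "i < n" "j < n" using carrier[of w] by auto
    then have "min i j < n" "max i j < n" by auto
    moreover have "min i j * n + max i j < n * n"
    proof -
      have "min i j * n + max i j < Suc (min i j) * n" using \<open>max i j < n\<close> by simp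
      also have "\<dots> \<le> n * n" using \<open>min i j < n\<close> by (intro mult_le_mono1) simp
      finally show ?thesis .
    qed
    moreover have "F w $$ (min i j, max i j) = F w $$ (i, j)"
      using sym[OF ij] by (simp add: min_def max_def)
    ultimately show "?G (?e w) $$ (i, j) = F w $$ (i, j)" using ij by simp
  qed (use carrier[of w] in auto)
  ultimately have meas: "(\<lambda>w. energy_real (F w)) \<in> borel_measurable M" by simp
  let ?z = "0\<^sub>m n n :: real mat"
  let ?b = "\<lambda>w. sqrt n * (\<Sum>i<n. \<Sum>j<n. \<bar>F w $$ (i, j)\<bar>)"
  have bound: "norm (energy_real (F w)) \<le> norm (\<bar>energy_real ?z\<bar> + ?b w)" for w
  proof -
    have "\<bar>energy_real (F w) - energy_real ?z\<bar>
        \<le> sqrt n * sqrt (\<Sum>i<n. \<Sum>j<n. (F w $$ (i, j))\<^sup>2)"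
      using energy_real_perturbation[OF carrier[of w], of ?z "{..<n}"] sym by auto
    also have "sqrt (\<Sum>i<n. \<Sum>j<n. (F w $$ (i, j))\<^sup>2) \<le> (\<Sum>i<n. \<Sum>j<n. \<bar>F w $$ (i, j)\<bar>)"
      using L2_set_le_sum_abs[of "\<lambda>(i, j). F w $$ (i, j)" "{..<n} \<times> {..<n}"]
      unfolding L2_set_def by (simp add: sum.cartesian_product case_prod_unfold)
    finally have "\<bar>energy_real (F w)\<bar> \<le> \<bar>energy_real ?z\<bar> + ?b w" by (simp add: mult_left_mono)
    then show ?thesis unfolding real_norm_def by (rule order_trans[OF _ abs_ge_self])
  qed
  have "integrable M (\<lambda>w. \<bar>energy_real ?z\<bar> + ?b w)"
    by (intro Bochner_Integration.integrable_add integrable_const integrable_mult_right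
        Bochner_Integration.integrable_sum integrable_abs int) auto
  then show ?thesis
    by (rule Bochner_Integration.integrable_bound[OF _ meas]) (intro AE_I2 bound)
qed

section \<open>Band Toeplitz against band circulant matrices\<close>

lemma band_toep_carrier: "band_toep n b x \<in> carrier_mat n n"
  and band_circ_carrier: "band_circ n b x \<in> carrier_mat n n"
  unfolding band_toep_def toep_s_def band_circ_def circ_def by auto

lemma band_toep_index:
  assumes "i < n" "j < n"
  shows "band_toep n b x $$ (i, j) =
    (let d = nat \<bar>int j - int i\<bar> in if 1 \<le> d \<and> d \<le> b then x d else 0)"
  using assms unfolding band_toep_def toep_s_def by (simp add: Let_def)

text \<open>The generating tuple of the circulant is invariant under \<open>k \<mapsto> n - k\<close>, so its entries
  depend only on \<open>\<bar>j - i\<bar>\<close>, as those of the Toeplitz matrix do. The condition \<open>2 * b < n\<close> keeps the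
  two bands \<open>d \<le> b\<close> and \<open>n - b \<le> d\<close> apart.\<close>

lemma band_circ_index:
  assumes "i < n" "j < n" "2 * b < n"
  shows "band_circ n b x $$ (i, j) =
    (let d = nat \<bar>int j - int i\<bar> in if 1 \<le> d \<and> d \<le> b then x d
      else if n - b \<le> d then x (n - d) else 0)"
proof (cases "i \<le> j")
  case True
  then have "(int j - int i) mod int n = int j - int i" using assms by simp
  then show ?thesis using True assms unfolding band_circ_def circ_def by (auto simp: Let_def)
next
  case False
  then obtain d where d: "i = j + d" "0 < d" using less_imp_add_positive[of j i] by auto
  have "(int j - int i) mod int n = (int n - int d) mod int n" using d by simp
  also have "\<dots> = int (n - d)" using d assms by (subst mod_pos_pos_trivial) auto
  finally have eq: "(int j - int (j + d)) mod int n = int (n - d)" using d by simp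
  show ?thesis using d assms unfolding band_circ_def circ_def
    by (simp add: eq Let_def del: of_nat_add of_nat_diff) auto
qed

lemma band_toep_sym:
  "i < n \<Longrightarrow> j < n \<Longrightarrow> band_toep n b x $$ (i, j) = band_toep n b x $$ (j, i)"
  by (simp add: band_toep_index abs_minus_commute)

lemma band_circ_sym:
  "i < n \<Longrightarrow> j < n \<Longrightarrow> 2 * b < n \<Longrightarrow> band_circ n b x $$ (i, j) = band_circ n b x $$ (j, i)"
  by (simp add: band_circ_index abs_minus_commute)

lemma band_toep_minus_circ_index:
  assumes "i < n" "j < n" "2 * b < n"
  shows "band_toep n b x $$ (i, j) - band_circ n b x $$ (i, j) =
    (let d = nat \<bar>int j - int i\<bar> in if n - b \<le> d then - x (n - d) else 0)"
  unfolding band_toep_index[OF assms(1,2)] band_circ_index[OF assms] using assms(3)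
  by (auto simp: Let_def)

text \<open>There are \<open>n\<close> positions on the diagonal and \<open>2 * (n - k)\<close> at distance \<open>k\<close> from it. The
  induction step adds the last row and column.\<close>

lemma sum_toeplitz:
  fixes f :: "nat \<Rightarrow> real"
  shows "(\<Sum>i<n. \<Sum>j<n. f (nat \<bar>int j - int i\<bar>)) = real n * f 0 + 2 * (\<Sum>k=1..<n. real (n - k) * f k)"
proof (induction n)
  case (Suc n)
  let ?g = "\<lambda>i j. f (nat \<bar>int j - int i\<bar>)"
  have row: "(\<Sum>j<n. ?g n j) = (\<Sum>k=1..n. f k)"
    by (rule sum.reindex_bij_witness[of _ "\<lambda>k. n - k" "\<lambda>j. n - j"])
       (auto simp: nat_diff_distrib intro!: arg_cong[where f = f])
  have "(\<Sum>i<Suc n. \<Sum>j<Suc n. ?g i j) = (\<Sum>i<n. \<Sum>j<n. ?g i j) + 2 * (\<Sum>j<n. ?g n j) + f 0"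
    by (simp add: sum.distrib abs_minus_commute)
  also have "\<dots> = real (Suc n) * f 0 + 2 * ((\<Sum>k=1..<n. real (n - k) * f k) + (\<Sum>k=1..n. f k))"
    unfolding Suc.IH row by (simp add: algebra_simps)
  also have "(\<Sum>k=1..<n. real (n - k) * f k) = (\<Sum>k=1..n. real (n - k) * f k)"
    by (rule sum.mono_neutral_left) auto
  also have "\<dots> + (\<Sum>k=1..n. f k) = (\<Sum>k=1..<Suc n. real (Suc n - k) * f k)"
    unfolding sum.distrib[symmetric] atLeastLessThanSuc_atLeastAtMost
    by (rule sum.cong) (auto simp: algebra_simps of_nat_diff Suc_diff_le)
  finally show ?case .
qed simp

text \<open>The value \<open>x k\<close> sits at distance \<open>n - k\<close> from the diagonal, hence at \<open>2 * k\<close> positions.\<close>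

lemma sum_band_toep_minus_circ:
  assumes "2 * b < n"
  shows "(\<Sum>i<n. \<Sum>j<n. (band_toep n b x $$ (i, j) - band_circ n b x $$ (i, j))\<^sup>2)
    = (\<Sum>k=1..b. 2 * real k * (x k)\<^sup>2)"
proof -
  let ?f = "\<lambda>d. (if n - b \<le> d then - x (n - d) else 0)\<^sup>2"
  have "(\<Sum>i<n. \<Sum>j<n. (band_toep n b x $$ (i, j) - band_circ n b x $$ (i, j))\<^sup>2)
    = (\<Sum>i<n. \<Sum>j<n. ?f (nat \<bar>int j - int i\<bar>))"
    using assms by (auto simp: band_toep_minus_circ_index Let_def intro!: sum.cong)
  also have "\<dots> = real n * ?f 0 + 2 * (\<Sum>k=1..<n. real (n - k) * ?f k)"
    by (rule sum_toeplitz)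
  also have "?f 0 = 0" using assms by simp
  also have "(\<Sum>k=1..<n. real (n - k) * ?f k) = (\<Sum>k=n-b..<n. real (n - k) * ?f k)"
    using assms by (intro sum.mono_neutral_right) auto
  also have "\<dots> = (\<Sum>k=1..b. real k * (x k)\<^sup>2)"
    using assms by (intro sum.reindex_bij_witness[of _ "\<lambda>k. n - k" "\<lambda>k. n - k"]) auto
  finally show ?thesis unfolding sum_distrib_left mult.assoc by (simp only: mult_zero_right add_0)
qed

text \<open>An entry at distance at least \<open>n - b\<close> from the diagonal lies in one of the first \<open>b\<close> or the
  last \<open>b\<close> rows.\<close>

theorem energy_band_toep_minus_circ:
  assumes "2 * b < n"
  shows "\<bar>energy_real (band_toep n b x) - energy_real (band_circ n b x)\<bar>
    \<le> sqrt (2 * b) * sqrt (\<Sum>k=1..b. 2 * real k * (x k)\<^sup>2)"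
proof -
  let ?R = "{..<b} \<union> {n - b..<n}"
  have "\<bar>energy_real (band_toep n b x) - energy_real (band_circ n b x)\<bar>
    \<le> sqrt (card ?R) * sqrt (\<Sum>i<n. \<Sum>j<n. (band_toep n b x $$ (i, j) - band_circ n b x $$ (i, j))\<^sup>2)"
  proof (rule energy_real_perturbation[OF band_toep_carrier band_circ_carrier band_toep_sym band_circ_sym])
    fix i j assume "i < n" "i \<notin> ?R" "j < n"
    then have "band_toep n b x $$ (i, j) - band_circ n b x $$ (i, j) = 0"
      using assms by (subst band_toep_minus_circ_index) (auto simp: Let_def)
    then show "band_toep n b x $$ (i, j) = band_circ n b x $$ (i, j)" by simp
  qed (use assms in auto)
  also have "card ?R = 2 * b" using assms by (subst card_Un_disjoint) auto
  finally show ?thesis unfolding sum_band_toep_minus_circ[OF assms] by simp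
qed

section \<open>Expectations\<close>

text \<open>Jensen's inequality for the square root, obtained from the nonnegativity of the variance of
  \<open>sqrt f\<close>.\<close>

lemma (in prob_space) expectation_sqrt_le:
  assumes int: "integrable M f" and nonneg: "\<And>w. 0 \<le> f w"
  shows "integrable M (\<lambda>w. sqrt (f w))" "expectation (\<lambda>w. sqrt (f w)) \<le> sqrt (expectation f)"
proof -
  have sq: "(\<lambda>w. (sqrt (f w))\<^sup>2) = f" using nonneg by auto
  have "(\<lambda>w. sqrt (f w)) \<in> borel_measurable M" using int by measurable
  then show int': "integrable M (\<lambda>w. sqrt (f w))"
    by (rule square_integrable_imp_integrable) (use int sq in simp)
  have "0 \<le> variance (\<lambda>w. sqrt (f w))" by (rule variance_positive)
  then have "(expectation (\<lambda>w. sqrt (f w)))\<^sup>2 \<le> expectation f"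
    using variance_eq[OF int'] int sq by simp
  then show "expectation (\<lambda>w. sqrt (f w)) \<le> sqrt (expectation f)"
    by (rule real_le_rsqrt)
qed

lemma (in prob_space) second_moment:
  fixes X :: "'a \<Rightarrow> real"
  assumes "integrable M X" "integrable M (\<lambda>w. \<bar>X w - c\<bar>\<^sup>2)" "expectation X = c"
  shows "integrable M (\<lambda>w. (X w)\<^sup>2)" "expectation (\<lambda>w. (X w)\<^sup>2) = expectation (\<lambda>w. \<bar>X w - c\<bar>\<^sup>2) + c\<^sup>2"
proof -
  have eq: "(\<lambda>w. (X w)\<^sup>2) = (\<lambda>w. \<bar>X w - c\<bar>\<^sup>2 + (2 * c * X w - c\<^sup>2))"
    by (auto simp: power2_eq_square algebra_simps)
  have "integrable M (\<lambda>w. 2 * c * X w - c\<^sup>2)" using assms(1) by auto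
  then show "integrable M (\<lambda>w. (X w)\<^sup>2)"
    unfolding eq by (intro Bochner_Integration.integrable_add assms(2))
  show "expectation (\<lambda>w. (X w)\<^sup>2) = expectation (\<lambda>w. \<bar>X w - c\<bar>\<^sup>2) + c\<^sup>2"
    unfolding eq using assms by (simp add: prob_space power2_eq_square)
qed

lemma integrable_energy_band:
  fixes \<xi> :: "nat \<Rightarrow> 'w \<Rightarrow> real"
  assumes "prob_space M" "2 * b < n" and int: "\<And>k. k \<in> {1..b} \<Longrightarrow> integrable M (\<xi> k)"
  shows "integrable M (\<lambda>\<omega>. energy_real (band_toep n b (\<lambda>l. \<xi> l \<omega>)))"
    and "integrable M (\<lambda>\<omega>. energy_real (band_circ n b (\<lambda>l. \<xi> l \<omega>)))"
proof -
  show "integrable M (\<lambda>\<omega>. energy_real (band_toep n b (\<lambda>l. \<xi> l \<omega>)))"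
  proof (rule integrable_energy_real[OF assms(1) band_toep_carrier band_toep_sym])
    fix i j assume ij: "i < n" "j < n"
    define d where "d = nat \<bar>int j - int i\<bar>"
    show "integrable M (\<lambda>\<omega>. band_toep n b (\<lambda>l. \<xi> l \<omega>) $$ (i, j))"
      unfolding band_toep_index[OF ij] Let_def d_def[symmetric]
      using int[of d] by (cases "1 \<le> d"; cases "d \<le> b") simp_all
  qed
  show "integrable M (\<lambda>\<omega>. energy_real (band_circ n b (\<lambda>l. \<xi> l \<omega>)))"
  proof (rule integrable_energy_real[OF assms(1) band_circ_carrier band_circ_sym])
    fix i j assume ij: "i < n" "j < n"
    define d where "d = nat \<bar>int j - int i\<bar>"
    have "d < n" using ij unfolding d_def by auto
    then have "integrable M (\<xi> (n - d))" if "n - b \<le> d" using that by (intro int) auto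
    then show "integrable M (\<lambda>\<omega>. band_circ n b (\<lambda>l. \<xi> l \<omega>) $$ (i, j))"
      unfolding band_circ_index[OF ij assms(2)] Let_def d_def[symmetric]
      using int[of d] by (cases "1 \<le> d"; cases "d \<le> b"; cases "n - b \<le> d") simp_all
  qed (use assms(2) in auto)
qed

lemma expectation_energy_band_le:
  fixes \<xi> :: "nat \<Rightarrow> 'w \<Rightarrow> real"
  assumes "prob_space M" "2 * b < n"
    and int: "\<And>k. k \<in> {1..b} \<Longrightarrow> integrable M (\<xi> k)"
    and int2: "\<And>k. k \<in> {1..b} \<Longrightarrow> integrable M (\<lambda>\<omega>. (\<xi> k \<omega>)\<^sup>2)"
    and m: "\<And>k. k \<in> {1..b} \<Longrightarrow> prob_space.expectation M (\<lambda>\<omega>. (\<xi> k \<omega>)\<^sup>2) = m"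
  shows "\<bar>prob_space.expectation M (\<lambda>\<omega>. energy_real (band_toep n b (\<lambda>l. \<xi> l \<omega>)))
      - prob_space.expectation M (\<lambda>\<omega>. energy_real (band_circ n b (\<lambda>l. \<xi> l \<omega>)))\<bar>
    \<le> sqrt (2 * b) * sqrt (real b * (real b + 1) * m)"
proof -
  interpret prob_space M by fact
  let ?T = "\<lambda>\<omega>. energy_real (band_toep n b (\<lambda>l. \<xi> l \<omega>))"
  let ?C = "\<lambda>\<omega>. energy_real (band_circ n b (\<lambda>l. \<xi> l \<omega>))"
  let ?Q = "\<lambda>\<omega>. \<Sum>k=1..b. 2 * real k * (\<xi> k \<omega>)\<^sup>2"
  note TC = integrable_energy_band[OF assms(1,2) int]
  have Q: "integrable M ?Q" by (intro Bochner_Integration.integrable_sum integrable_mult_right int2)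
  have "(\<Sum>k=1..b. 2 * real k) = real b * (real b + 1)"
    by (induction b) (auto simp: algebra_simps)
  moreover have "expectation ?Q = (\<Sum>k=1..b. 2 * real k * m)"
    using int2 m by (subst Bochner_Integration.integral_sum) auto
  ultimately have EQ: "expectation ?Q = real b * (real b + 1) * m"
    by (simp flip: sum_distrib_right)
  note sqrtQ = expectation_sqrt_le[OF Q sum_nonneg]
  have "\<bar>expectation ?T - expectation ?C\<bar> = \<bar>expectation (\<lambda>\<omega>. ?T \<omega> - ?C \<omega>)\<bar>"
    using TC by simp
  also have "\<dots> \<le> expectation (\<lambda>\<omega>. \<bar>?T \<omega> - ?C \<omega>\<bar>)"
    by (rule integral_abs_bound)
  also have "\<dots> \<le> expectation (\<lambda>\<omega>. sqrt (2 * b) * sqrt (?Q \<omega>))"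
    using TC sqrtQ(1) energy_band_toep_minus_circ[OF assms(2)]
    by (intro integral_mono integrable_abs Bochner_Integration.integrable_diff integrable_mult_right) auto
  also have "\<dots> = sqrt (2 * b) * expectation (\<lambda>\<omega>. sqrt (?Q \<omega>))" by simp
  also have "\<dots> \<le> sqrt (2 * b) * sqrt (real b * (real b + 1) * m)"
    using sqrtQ(2) unfolding EQ by (intro mult_left_mono) auto
  finally show ?thesis .
qed

theorem theorem3:
  fixes M :: "'w measure"
    and n b :: nat
    and \<xi> :: "nat \<Rightarrow> 'w \<Rightarrow> real"
    and a \<sigma> :: real
  assumes prob: "prob_space M"
    and b: "1 \<le> b" "real b < real n / 2"
    and indep: "prob_space.indep_vars M (\<lambda>_. borel) \<xi> {1..b}"
    and ident: "\<And>i j. i \<in> {1..b} \<Longrightarrow> j \<in> {1..b} \<Longrightarrow> distr M borel (\<xi> i) = distr M borel (\<xi> j)"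
    and int1: "\<And>k. k \<in> {1..b} \<Longrightarrow> integrable M (\<xi> k)"
    and mean: "\<And>k. k \<in> {1..b} \<Longrightarrow> prob_space.expectation M (\<xi> k) = a"
    and int2: "\<And>k. k \<in> {1..b} \<Longrightarrow> integrable M (\<lambda>\<omega>. \<bar>\<xi> k \<omega> - a\<bar> ^ 2)"
    and var: "\<And>k. k \<in> {1..b} \<Longrightarrow> prob_space.expectation M (\<lambda>\<omega>. \<bar>\<xi> k \<omega> - a\<bar> ^ 2) = \<sigma> ^ 2"
    and sigma: "0 \<le> \<sigma>"
    and int3: "\<And>k. k \<in> {1..b} \<Longrightarrow> integrable M (\<lambda>\<omega>. \<bar>\<xi> k \<omega> - a\<bar> ^ 3)"
  shows "\<forall>k \<in> {1..b}.
      1 / (real n * sqrt (real b)) *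
        \<bar>prob_space.expectation M (\<lambda>\<omega>. energy_real (band_toep n b (\<lambda>l. \<xi> l \<omega>)))
          - prob_space.expectation M (\<lambda>\<omega>. energy_real (band_circ n b (\<lambda>l. \<xi> l \<omega>)))\<bar>
        \<le> sqrt (prob_space.expectation M (\<lambda>\<omega>. (\<xi> k \<omega>) ^ 2)) / real n
            * sqrt (2 * real b * (real b + 1))
    \<and> sqrt (prob_space.expectation M (\<lambda>\<omega>. (\<xi> k \<omega>) ^ 2)) / real n
            * sqrt (2 * real b * (real b + 1))
        \<le> 2 * (\<bar>a\<bar> + \<sigma>) * (real b / real n)"
proof -
  interpret prob_space M by fact
  define m where "m = \<sigma>\<^sup>2 + a\<^sup>2"
  have n: "2 * b < n" "0 < real n" "0 < real b" using b by auto
  have int: "integrable M (\<lambda>\<omega>. (\<xi> k \<omega>)\<^sup>2)" and m: "expectation (\<lambda>\<omega>. (\<xi> k \<omega>)\<^sup>2) = m"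
    if "k \<in> {1..b}" for k
    using second_moment[OF int1[OF that] int2[OF that] mean[OF that]] var[OF that]
    unfolding m_def by auto
  let ?\<Delta> = "\<bar>expectation (\<lambda>\<omega>. energy_real (band_toep n b (\<lambda>l. \<xi> l \<omega>)))
    - expectation (\<lambda>\<omega>. energy_real (band_circ n b (\<lambda>l. \<xi> l \<omega>)))\<bar>"
  have "?\<Delta> \<le> sqrt (2 * b) * sqrt (real b * (real b + 1) * m)"
    by (rule expectation_energy_band_le[OF prob n(1) int1 int m])
  then have "1 / (real n * sqrt b) * ?\<Delta>
    \<le> 1 / (real n * sqrt b) * (sqrt (2 * b) * sqrt (real b * (real b + 1) * m))"
    by (intro mult_left_mono) auto
  also have "sqrt (2 * b) * sqrt (real b * (real b + 1) * m)
    = sqrt m * sqrt b * sqrt (2 * real b * (real b + 1))"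
    by (simp add: real_sqrt_mult)
  also have "1 / (real n * sqrt b) * \<dots> = sqrt m / n * sqrt (2 * real b * (real b + 1))"
    using n by simp
  finally have 1: "1 / (real n * sqrt b) * ?\<Delta> \<le> sqrt m / n * sqrt (2 * real b * (real b + 1))" .
  have "sqrt m \<le> \<bar>a\<bar> + \<sigma>"
    using sqrt_sum_squares_le_sum_abs[of \<sigma> a] sigma unfolding m_def by simp
  moreover have "sqrt (2 * real b * (real b + 1)) \<le> 2 * b"
  proof (rule real_le_lsqrt)
    have "real b * 1 \<le> real b * real b" using b by (intro mult_left_mono) auto
    then show "2 * real b * (real b + 1) \<le> (real (2 * b))\<^sup>2"
      by (simp add: power2_eq_square algebra_simps)
  qed auto
  ultimately have "sqrt m * sqrt (2 * real b * (real b + 1)) \<le> (\<bar>a\<bar> + \<sigma>) * (2 * b)"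
    using sigma by (intro mult_mono) auto
  then have "sqrt m / n * sqrt (2 * real b * (real b + 1)) \<le> 2 * (\<bar>a\<bar> + \<sigma>) * (real b / real n)"
    using n by (simp add: field_simps)
  with 1 show ?thesis using m by simp
qed

end
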